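(* Let $\lambda>0$. For a harmonic function $f(z)=h(z)+\overline{g(z)}\in\Omega_{\mathcal{H}}^0(\lambda)$, there exists an analytic function $F_{\zeta}(z)=h(z)+\zeta g(z)\in\Omega(\lambda)$, and vice versa, where $|\zeta|=1$.
   Context: $\mathbb{D}=\{z\in\mathbb{C}:|z|<1\}$. $\mathcal{A}$ is the class of analytic functions $F$ on $\mathbb{D}$ with $F(0)=0$, $F'(0)=1$. $\mathcal{H}^0$ is the class of complex-valued harmonic functions $f=h+\overline{g}$ on $\mathbb{D}$, where $h,g$ are analytic on $\mathbb{D}$ with $h(z)=z+\sum_{n\ge2}a_nz^n$ and $g(z)=\sum_{n\ge2}b_nz^n$. For $\lambda>0$, $\Omega_{\mathcal{H}}^0(\lambda)$ is the set of $f=h+\overline{g}\in\mathcal{H}^0$ such that $|h(z)-zh'(z)|<\lambda-|g(z)-zg'(z)|$ for all $z\in\mathbb{D}$. For $\lambda>0$, $\Omega(\lambda)$ is the set of $F\in\mathcal{A}$ such that $|F(z)-zF'(z)|<\lambda$ for all $z\in\mathbb{D}$. *)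

theory Defs
  imports "HOL-Complex_Analysis.Complex_Analysis"
begin

text \<open>
  Functions on the open unit disc \<^term>\<open>ball 0 1 :: complex set\<close> are represented by total
  functions of type \<^typ>\<open>complex \<Rightarrow> complex\<close>; none of the notions below depends on values
  outside the disc.
\<close>

definition class_A :: "(complex \<Rightarrow> complex) set" where
  "class_A = {F. F analytic_on ball 0 1 \<and> F 0 = 0 \<and> deriv F 0 = 1}"

text \<open>
  \<open>f = h + cnj g\<close> on the disc, where \<open>h\<close> and \<open>g\<close> are analytic there with
  \<open>h(z) = z + (\<Sum>n\<ge>2. a\<^sub>n z^n)\<close> and \<open>g(z) = (\<Sum>n\<ge>2. b\<^sub>n z^n)\<close>. The series are indexed from 0,
  so the exponent is shifted by 2. Such an \<open>f\<close> is automatically harmonic.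
\<close>

definition canonical_decomposition ::
    "(complex \<Rightarrow> complex) \<Rightarrow> (complex \<Rightarrow> complex) \<Rightarrow> (complex \<Rightarrow> complex) \<Rightarrow> bool" where
  "canonical_decomposition f h g \<longleftrightarrow>
     h analytic_on ball 0 1 \<and> g analytic_on ball 0 1 \<and>
     (\<exists>a. \<forall>z\<in>ball 0 1. (\<lambda>n. a (n + 2) * z ^ (n + 2)) sums (h z - z)) \<and>
     (\<exists>b. \<forall>z\<in>ball 0 1. (\<lambda>n. b (n + 2) * z ^ (n + 2)) sums g z) \<and>
     (\<forall>z\<in>ball 0 1. f z = h z + cnj (g z))"

definition class_H0 :: "(complex \<Rightarrow> complex) set" where
  "class_H0 = {f. \<exists>h g. canonical_decomposition f h g}"

definition Omega_H0 :: "real \<Rightarrow> (complex \<Rightarrow> complex) set" where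
  "Omega_H0 lam = {f \<in> class_H0. \<exists>h g. canonical_decomposition f h g \<and>
     (\<forall>z\<in>ball 0 1. norm (h z - z * deriv h z) < lam - norm (g z - z * deriv g z))}"

definition Omega :: "real \<Rightarrow> (complex \<Rightarrow> complex) set" where
  "Omega lam = {F \<in> class_A. \<forall>z\<in>ball 0 1. norm (F z - z * deriv F z) < lam}"

end

theory Submission
  imports Defs
begin

text \<open>
  The decomposition \<open>f = h + cnj g\<close> is unique on the disc, because a function that is holomorphic
  together with its conjugate is locally constant. Hence membership of \<open>f\<close> in the harmonic class
  is a condition on the given \<open>h\<close> and \<open>g\<close>. With \<open>A = h - z h'\<close> and \<open>B = g - z g'\<close>, the theorem
  then reduces to the fact that the maximum of \<open>|A + \<zeta> B|\<close> over the unit circle is \<open>|A| + |B|\<close>.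
\<close>

text \<open>The real derivative of the conjugate of \<open>f\<close> is antilinear over the complex
  numbers, while complex differentiability makes it linear. Only the zero map is both.\<close>

lemma has_field_derivative_cnj_imp_zero:
  assumes f: "(f has_field_derivative a) (at z)"
    and cnj_f: "((\<lambda>w. cnj (f w)) has_field_derivative b) (at z)"
  shows "a = 0"
proof -
  have "((\<lambda>w. cnj (f w)) has_derivative (\<lambda>x. cnj (a * x))) (at z)"
    using f unfolding has_field_derivative_def by (rule has_derivative_cnj)
  moreover have "((\<lambda>w. cnj (f w)) has_derivative (\<lambda>x. b * x)) (at z)"
    using cnj_f unfolding has_field_derivative_def .
  ultimately have eq: "(\<lambda>x. cnj (a * x)) = (\<lambda>x. b * x)"
    by (rule has_derivative_unique)
  \<comment> \<open>At 1 this gives \<open>cnj a = b\<close>, at \<open>\<i>\<close> it gives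
    \<open>- cnj a = b\<close>.\<close>
  show ?thesis
    using fun_cong[OF eq, of 1] fun_cong[OF eq, of \<i>] by (simp add: complex_eq_iff)
qed

lemma holomorphic_cnj_imp_constant_on:
  assumes f: "f holomorphic_on S" and cnj_f: "(\<lambda>w. cnj (f w)) holomorphic_on S"
    and S: "open S" "connected S"
  shows "f constant_on S"
proof -
  have "(f has_field_derivative 0) (at z)" if z: "z \<in> S" for z
    using has_field_derivative_cnj_imp_zero holomorphic_derivI[OF f S(1) z]
      holomorphic_derivI[OF cnj_f S(1) z] by metis
  then obtain c where "\<And>z. z \<in> S \<Longrightarrow> f z = c"
    using DERIV_zero_connected_constant_on[OF S(2,1) finite.emptyI holomorphic_on_imp_continuous_on[OF f]]
    by (auto simp: constant_on_def)
  then show ?thesis by (auto simp: constant_on_def)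
qed

text \<open>Extracts from the series encoding what is used later: the function vanishes to order at
  least two at 0.\<close>

lemma powser_from_2_at_0:
  fixes f :: "complex \<Rightarrow> complex"
  assumes "\<And>z. z \<in> ball 0 1 \<Longrightarrow> (\<lambda>n. c (n + 2) * z ^ (n + 2)) sums f z"
  shows "f 0 = 0" and "(f has_field_derivative 0) (at 0)"
proof -
  \<comment> \<open>Padding with two zero coefficients gives an ordinary power series, which can be
    differentiated termwise.\<close>
  define d where "d n = (if n < 2 then 0 else c n)" for n
  have d_sums: "(\<lambda>n. d n * z ^ n) sums f z" if "z \<in> ball 0 1" for z
    using sums_zero_iff_shift[of 2 "\<lambda>n. d n * z ^ n" "f z"] assms[OF that]
    by (simp add: d_def)
  show "f 0 = 0"
    using sums_unique2[OF d_sums[of 0] powser_sums_zero[of d]] by (simp add: d_def)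
  \<comment> \<open>Convergence at some nonzero point puts 0 strictly inside the disc of
    convergence.\<close>
  have "summable (\<lambda>n. d n * (1 / 2) ^ n)"
    using d_sums[of "1 / 2"] by (auto simp: sums_iff)
  then have "((\<lambda>z. \<Sum>n. d n * z ^ n) has_field_derivative (\<Sum>n. diffs d n * 0 ^ n)) (at 0)"
    by (rule termdiffs_strong) simp
  then have "((\<lambda>z. \<Sum>n. d n * z ^ n) has_field_derivative 0) (at 0)"
    by (simp add: diffs_def d_def)
  then show "(f has_field_derivative 0) (at 0)"
    by (rule has_field_derivative_transform_within_open[of _ _ _ "ball 0 1"])
      (use d_sums in \<open>auto simp: sums_iff\<close>)
qed

lemma canonical_decomposition_at_0:
  assumes "canonical_decomposition f h g"
  shows "h 0 = 0" "(h has_field_derivative 1) (at 0)"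
    and "g 0 = 0" "(g has_field_derivative 0) (at 0)"
proof -
  obtain a b
    where a: "\<And>z. z \<in> ball 0 1 \<Longrightarrow> (\<lambda>n. a (n + 2) * z ^ (n + 2)) sums (h z - z)"
      and b: "\<And>z. z \<in> ball 0 1 \<Longrightarrow> (\<lambda>n. b (n + 2) * z ^ (n + 2)) sums g z"
    using assms unfolding canonical_decomposition_def by blast
  show "h 0 = 0" using powser_from_2_at_0(1)[OF a] by simp
  show "(h has_field_derivative 1) (at 0)"
    using DERIV_add[OF powser_from_2_at_0(2)[OF a] DERIV_ident] by simp
  show "g 0 = 0" by (rule powser_from_2_at_0(1)[OF b])
  show "(g has_field_derivative 0) (at 0)" by (rule powser_from_2_at_0(2)[OF b])
qed

lemma canonical_decomposition_unique:
  assumes d1: "canonical_decomposition f h g" and d2: "canonical_decomposition f k l"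
    and z: "z \<in> ball 0 1"
  shows "h z = k z" "g z = l z"
proof -
  have hol: "h holomorphic_on ball 0 1" "g holomorphic_on ball 0 1"
      "k holomorphic_on ball 0 1" "l holomorphic_on ball 0 1"
    using d1 d2 by (auto simp: canonical_decomposition_def analytic_imp_holomorphic)
  \<comment> \<open>Separating the analytic from the conjugated parts exhibits the conjugate of
    \<open>h - k\<close> as a holomorphic function.\<close>
  have eq: "l w - g w = cnj (h w - k w)" if "w \<in> ball 0 1" for w
  proof -
    have "h w + cnj (g w) = k w + cnj (l w)"
      using d1 d2 that by (auto simp: canonical_decomposition_def)
    then show ?thesis by (simp add: complex_eq_iff)
  qed
  have "(\<lambda>w. l w - g w) holomorphic_on ball 0 1"
    using hol by (intro holomorphic_intros)
  then have "(\<lambda>w. cnj (h w - k w)) holomorphic_on ball 0 1"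
    by (rule holomorphic_transform) (rule eq)
  moreover have "(\<lambda>w. h w - k w) holomorphic_on ball 0 1"
    using hol by (intro holomorphic_intros)
  ultimately have "(\<lambda>w. h w - k w) constant_on ball 0 1"
    by (intro holomorphic_cnj_imp_constant_on) auto
  \<comment> \<open>The normalisation at 0 forces the constant to be zero.\<close>
  then have "h z - k z = h 0 - k 0"
    using z unfolding constant_on_def by (metis centre_in_ball zero_less_one)
  then show "h z = k z"
    using canonical_decomposition_at_0(1)[OF d1] canonical_decomposition_at_0(1)[OF d2] by simp
  then show "g z = l z" using eq[OF z] by simp
qed

lemma deriv_eq_on_open:
  assumes "open S" "z \<in> S" "\<And>w. w \<in> S \<Longrightarrow> f w = g w"
  shows "deriv f z = deriv g z"
  using assms by (intro deriv_cong_ev refl) (auto simp: eventually_nhds)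

text \<open>\<open>Omega_H0\<close> asks for some decomposition satisfying the bound; by uniqueness
  the given one can be tested instead.\<close>

lemma Omega_H0_iff:
  assumes d: "canonical_decomposition f h g"
  shows "f \<in> Omega_H0 lam \<longleftrightarrow>
    (\<forall>z\<in>ball 0 1. norm (h z - z * deriv h z) < lam - norm (g z - z * deriv g z))"
proof
  assume "f \<in> Omega_H0 lam"
  then obtain k l where d': "canonical_decomposition f k l"
    and less: "\<forall>z\<in>ball 0 1. norm (k z - z * deriv k z) < lam - norm (l z - z * deriv l z)"
    by (auto simp: Omega_H0_def)
  show "\<forall>z\<in>ball 0 1. norm (h z - z * deriv h z) < lam - norm (g z - z * deriv g z)"
  proof
    fix z :: complex assume z: "z \<in> ball 0 1"
    note uniq = canonical_decomposition_unique[OF d d']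
    \<comment> \<open>The functions may differ outside the disc, but it is open, so agreement there
      determines the derivatives.\<close>
    have "deriv h z = deriv k z" "deriv g z = deriv l z"
      using uniq by (auto intro!: deriv_eq_on_open[OF open_ball z])
    then show "norm (h z - z * deriv h z) < lam - norm (g z - z * deriv g z)"
      using less z uniq[OF z] by metis
  qed
next
  assume "\<forall>z\<in>ball 0 1. norm (h z - z * deriv h z) < lam - norm (g z - z * deriv g z)"
  then show "f \<in> Omega_H0 lam"
    using d unfolding Omega_H0_def class_H0_def by blast
qed

lemma canonical_decomposition_class_A:
  assumes "canonical_decomposition f h g"
  shows "(\<lambda>z. h z + c * g z) \<in> class_A"
proof -
  note at_0 = canonical_decomposition_at_0[OF assms]
  have "(\<lambda>z. h z + c * g z) analytic_on ball 0 1"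
    using assms by (auto simp: canonical_decomposition_def intro!: analytic_intros)
  moreover have "deriv (\<lambda>z. h z + c * g z) 0 = 1"
    using DERIV_imp_deriv[OF DERIV_add[OF at_0(2) DERIV_cmult[OF at_0(4), of c]]] by simp
  ultimately show ?thesis
    using at_0 by (simp add: class_A_def)
qed

lemma norm_add_less_on_unit_circle_iff:
  fixes A B :: complex
  shows "(\<forall>c. norm c = 1 \<longrightarrow> norm (A + c * B) < r) \<longleftrightarrow> norm A + norm B < r"
proof
  assume less: "\<forall>c. norm c = 1 \<longrightarrow> norm (A + c * B) < r"
  show "norm A + norm B < r"
  \<comment> \<open>\<open>sgn 0 = 0\<close>, so the witness chosen below has modulus 1 only when
    both numbers are nonzero.\<close>
  proof (cases "A = 0 \<or> B = 0")
    case True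
    then show ?thesis using less[rule_format, of 1] by auto
  next
    case False
    \<comment> \<open>This rotation turns \<open>B\<close> into the direction of \<open>A\<close>,
      giving equality in the triangle inequality.\<close>
    define c where "c = sgn A * cnj (sgn B)"
    have "norm c = 1"
      using False by (simp add: c_def norm_mult norm_sgn)
    moreover have "c * B = sgn A * norm B"
      using False complex_norm_square[of B]
      by (simp add: c_def sgn_eq field_simps power2_eq_square)
    moreover have "A = sgn A * norm A"
      using False by (simp add: sgn_eq)
    ultimately have "norm (sgn A * of_real (norm A + norm B)) < r"
      using less by (metis distrib_left of_real_add)
    then show ?thesis
      using False by (simp add: norm_mult norm_sgn del: of_real_add)
  qed
next
  assume less: "norm A + norm B < r"
  show "\<forall>c. norm c = 1 \<longrightarrow> norm (A + c * B) < r"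
  proof (intro allI impI)
    fix c :: complex assume "norm c = 1"
    then show "norm (A + c * B) < r"
      using less norm_triangle_ineq[of A "c * B"] by (simp add: norm_mult)
  qed
qed

theorem theorem2p1:
  fixes lam :: real and f h g :: "complex \<Rightarrow> complex"
  assumes "lam > 0"
    and "canonical_decomposition f h g"
  shows "f \<in> Omega_H0 lam \<longleftrightarrow>
    (\<forall>\<zeta>::complex. norm \<zeta> = 1 \<longrightarrow> (\<lambda>z. h z + \<zeta> * g z) \<in> Omega lam)"
proof -
  define A where "A z = h z - z * deriv h z" for z
  define B where "B z = g z - z * deriv g z" for z
  have deriv_sum: "h z + c * g z - z * deriv (\<lambda>z. h z + c * g z) z = A z + c * B z"
    if z: "z \<in> ball 0 1" for z c
  proof -
    have "h field_differentiable at z" "g field_differentiable at z"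
      using assms(2) z analytic_on_imp_differentiable_at
      by (auto simp: canonical_decomposition_def)
    then have "deriv (\<lambda>z. h z + c * g z) z = deriv h z + c * deriv g z"
      by (intro DERIV_imp_deriv DERIV_add DERIV_cmult) (simp_all add: field_differentiable_derivI)
    then show ?thesis by (simp add: A_def B_def algebra_simps)
  qed
  have Omega_iff: "(\<lambda>z. h z + c * g z) \<in> Omega lam \<longleftrightarrow> (\<forall>z\<in>ball 0 1. norm (A z + c * B z) < lam)"
    for c
    using canonical_decomposition_class_A[OF assms(2)] deriv_sum by (simp add: Omega_def)
  have "f \<in> Omega_H0 lam \<longleftrightarrow> (\<forall>z\<in>ball 0 1. norm (A z) + norm (B z) < lam)"
    unfolding Omega_H0_iff[OF assms(2)] A_def B_def by (simp add: less_diff_eq)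
  also have "\<dots> \<longleftrightarrow> (\<forall>z\<in>ball 0 1. \<forall>c. norm c = 1 \<longrightarrow> norm (A z + c * B z) < lam)"
    by (simp only: norm_add_less_on_unit_circle_iff)
  \<comment> \<open>The extremal \<open>c\<close> varies with \<open>z\<close>, but both quantifiers
    are universal and so commute.\<close>
  also have "\<dots> \<longleftrightarrow> (\<forall>c. norm c = 1 \<longrightarrow> (\<lambda>z. h z + c * g z) \<in> Omega lam)"
    unfolding Omega_iff by blast
  finally show ?thesis .
qed

end
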